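(* Suppose that for $i=1,2$ the space $(E_i,\tau_i)$ is a locally solid Riesz space having an order bounded $\tau_i$-neighborhood of zero. If any one of the following conditions is satisfied, then $\mathcal{L}_{b}(E_1,E_2)=\mathcal{L}_{tb}(E_1,E_2)=\mathcal{L}_{tc}(E_1,E_2)$: (i) $(E_1,\tau_1)$ has a countable neighborhood base at zero. (ii) For each $i=1,2$, $(E_i,\tau_i)$ has a $\tau_i$-bounded convex neighborhood of zero. (iii) For each $i=1,2$, $(E_i,\tau_i)$ is a locally convex Hausdorff space. (iv) $(E_1,\tau_1)$ is bornological and $(E_2,\tau_2)$ is locally convex.
   Context: A Riesz space is a real vector lattice. A locally solid Riesz space $(E,\tau)$ is a Riesz space with a linear (vector space) topology $\tau$, not assumed Hausdorff, having a base of neighborhoods of zero consisting of solid sets ($A$ is solid if $|x|\le|y|$ and $y\in A$ imply $x\in A$). A subset is order bounded if it is contained in some order interval $[x,y]=\{z: x\le z\le y\}$; it is $\tau$-bounded (topologically bounded) if it is absorbed by every $\tau$-neighborhood of zero. A bornological space is a locally convex space in which every convex circled (balanced) set that absorbs all topologically bounded sets is a neighborhood of zero; equivalently, a locally convex space such that every topologically bounded linear operator from it to a locally convex space is continuous. Operators are linear maps $T:E_1\to E_2$. $\mathcal{L}_b(E_1,E_2)$ is the space of order bounded operators (mapping order bounded sets to order bounded sets); $\mathcal{L}_{tb}(E_1,E_2)$ is the space of topologically bounded operators (mapping $\tau_1$-bounded sets to $\tau_2$-bounded sets); $\mathcal{L}_{tc}(E_1,E_2)$ is the space of topologically continuous operators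 (continuous from $\tau_1$ to $\tau_2$). *)

theory Defs
  imports "HOL-Analysis.Analysis" "HOL-Library.Lattice_Algebras"
begin

text \<open>
  The class \<open>lattice_ab_group_add_abs\<close> supplies \<open>\<bar>x\<bar> = sup x (- x)\<close>. The topology is kept as an explicit
  argument, as in \<open>(E, \<tau>)\<close>, and is not assumed to be Hausdorff.
\<close>

class riesz_space = ordered_real_vector + lattice_ab_group_add_abs

definition linear_topology :: "'a::real_vector topology \<Rightarrow> bool" where
  "linear_topology \<tau> \<longleftrightarrow>
     topspace \<tau> = UNIV \<and>
     continuous_map (prod_topology \<tau> \<tau>) \<tau> (\<lambda>(x, y). x + y) \<and>
     continuous_map (prod_topology euclideanreal \<tau>) \<tau> (\<lambda>(c, x). c *\<^sub>R x)"

definition solid :: "'a::riesz_space set \<Rightarrow> bool" where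
  "solid A \<longleftrightarrow> (\<forall>x y. \<bar>x\<bar> \<le> \<bar>y\<bar> \<and> y \<in> A \<longrightarrow> x \<in> A)"

definition locally_solid :: "'a::riesz_space topology \<Rightarrow> bool" where
  "locally_solid \<tau> \<longleftrightarrow> linear_topology \<tau> \<and> neighbourhood_base_at 0 solid \<tau>"

definition zero_nhd :: "'a::real_vector topology \<Rightarrow> 'a set \<Rightarrow> bool" where
  "zero_nhd \<tau> U \<longleftrightarrow> (\<exists>W. openin \<tau> W \<and> 0 \<in> W \<and> W \<subseteq> U)"

definition order_bounded :: "'a::order set \<Rightarrow> bool" where
  "order_bounded S \<longleftrightarrow> (\<exists>x y. S \<subseteq> {x..y})"

text \<open>
  For circled \<open>U\<close>, or quantified over all zero neighborhoods of a linear topology, this agrees with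
  the convention asking for a single \<open>c > 0\<close> with \<open>S \<subseteq> c U\<close>.
\<close>

definition absorbs :: "'a::real_vector set \<Rightarrow> 'a set \<Rightarrow> bool" where
  "absorbs U S \<longleftrightarrow> (\<exists>r>0. \<forall>c. r \<le> \<bar>c\<bar> \<longrightarrow> S \<subseteq> (*\<^sub>R) c ` U)"

definition top_bounded :: "'a::real_vector topology \<Rightarrow> 'a set \<Rightarrow> bool" where
  "top_bounded \<tau> S \<longleftrightarrow> (\<forall>U. zero_nhd \<tau> U \<longrightarrow> absorbs U S)"

definition circled :: "'a::real_vector set \<Rightarrow> bool" where
  "circled A \<longleftrightarrow> (\<forall>c x. \<bar>c\<bar> \<le> 1 \<and> x \<in> A \<longrightarrow> c *\<^sub>R x \<in> A)"

definition locally_convex :: "'a::real_vector topology \<Rightarrow> bool" where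
  "locally_convex \<tau> \<longleftrightarrow> linear_topology \<tau> \<and> neighbourhood_base_at 0 convex \<tau>"

definition bornological :: "'a::real_vector topology \<Rightarrow> bool" where
  "bornological \<tau> \<longleftrightarrow>
     locally_convex \<tau> \<and>
     (\<forall>A. convex A \<and> circled A \<and> (\<forall>S. top_bounded \<tau> S \<longrightarrow> absorbs A S) \<longrightarrow> zero_nhd \<tau> A)"

definition order_bounded_ops :: "('a::riesz_space \<Rightarrow> 'b::riesz_space) set" where
  "order_bounded_ops = {T. linear T \<and> (\<forall>S. order_bounded S \<longrightarrow> order_bounded (T ` S))}"

definition top_bounded_ops ::
  "'a::real_vector topology \<Rightarrow> 'b::real_vector topology \<Rightarrow> ('a \<Rightarrow> 'b) set" where
  "top_bounded_ops \<tau>1 \<tau>2 = {T. linear T \<and> (\<forall>S. top_bounded \<tau>1 S \<longrightarrow> top_bounded \<tau>2 (T ` S))}"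

definition top_continuous_ops ::
  "'a::real_vector topology \<Rightarrow> 'b::real_vector topology \<Rightarrow> ('a \<Rightarrow> 'b) set" where
  "top_continuous_ops \<tau>1 \<tau>2 = {T. linear T \<and> continuous_map \<tau>1 \<tau>2 T}"

end

theory Submission
  imports Defs
begin

text \<open>
  In a locally solid Riesz space every order interval is topologically bounded: a solid zero
  neighborhood that contains a small multiple of \<open>u\<close> contains the same multiple of everything
  dominated by \<open>u\<close> (\<open>order_bounded_imp_top_bounded\<close>). Conversely, a topologically bounded set is
  absorbed by every zero neighborhood, so it is order bounded as soon as one of these is
  (\<open>top_bounded_imp_order_bounded\<close>). Hence an order bounded zero neighborhood makes the two kinds
  of boundedness coincide, and this on both sides gives \<open>\<L>\<^sub>b = \<L>\<^sub>t\<^sub>b\<close>.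

  Such a neighborhood \<open>U\<close> is then itself topologically bounded, so the sets \<open>\<epsilon> U\<close> with \<open>\<epsilon> > 0\<close> form
  a base at zero, as the balls do in a normed space. An operator that sends \<open>U\<close> to a bounded set
  is therefore continuous, by the argument familiar from normed spaces
  (\<open>bounded_image_of_zero_nhd_imp_continuous_map\<close>); that continuous operators preserve boundedness
  holds for any two linear topologies.
\<close>

lemma linear_topology_continuous_translation:
  assumes "linear_topology \<tau>"
  shows "continuous_map \<tau> \<tau> (\<lambda>x. x + a)"
proof -
  have "continuous_map \<tau> (prod_topology \<tau> \<tau>) (\<lambda>x. (x, a))"
    using assms by (auto simp: continuous_map_pairwise o_def linear_topology_def)
  moreover have "continuous_map (prod_topology \<tau> \<tau>) \<tau> (\<lambda>(x, y). x + y)"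
    using assms by (simp add: linear_topology_def)
  ultimately show ?thesis
    using continuous_map_compose by (fastforce simp: o_def)
qed

lemma linear_topology_continuous_scaleR:
  assumes "linear_topology \<tau>"
  shows "continuous_map \<tau> \<tau> (\<lambda>x. c *\<^sub>R x)"
proof -
  have "continuous_map \<tau> (prod_topology euclideanreal \<tau>) (\<lambda>x. (c, x))"
    by (auto simp: continuous_map_pairwise o_def)
  moreover have "continuous_map (prod_topology euclideanreal \<tau>) \<tau> (\<lambda>(c, x). c *\<^sub>R x)"
    using assms by (simp add: linear_topology_def)
  ultimately show ?thesis
    using continuous_map_compose by (fastforce simp: o_def)
qed

lemma linear_topology_continuous_line:
  assumes "linear_topology \<tau>"
  shows "continuous_map euclideanreal \<tau> (\<lambda>c. c *\<^sub>R x)"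
proof -
  have "continuous_map euclideanreal (prod_topology euclideanreal \<tau>) (\<lambda>c. (c, x))"
    using assms by (auto simp: continuous_map_pairwise o_def linear_topology_def)
  moreover have "continuous_map (prod_topology euclideanreal \<tau>) \<tau> (\<lambda>(c, x). c *\<^sub>R x)"
    using assms by (simp add: linear_topology_def)
  ultimately show ?thesis
    using continuous_map_compose by (fastforce simp: o_def)
qed

lemma openin_preimage:
  assumes "continuous_map \<tau> \<sigma> f" "topspace \<tau> = UNIV" "openin \<sigma> V"
  shows "openin \<tau> {x. f x \<in> V}"
  using openin_continuous_map_preimage[OF assms(1,3)] assms(2) by simp

lemma zero_nhd_contains_small_multiples:
  assumes lin: "linear_topology \<tau>" and V: "zero_nhd \<tau> V"
  obtains e where "e > 0" "\<And>t. \<bar>t\<bar> < e \<Longrightarrow> t *\<^sub>R x \<in> V"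
proof -
  obtain W where W: "openin \<tau> W" "0 \<in> W" "W \<subseteq> V"
    using V by (auto simp: zero_nhd_def)
  have "open {t. t *\<^sub>R x \<in> W}"
    using openin_preimage[OF linear_topology_continuous_line[OF lin] _ W(1)] by simp
  moreover have "0 \<in> {t. t *\<^sub>R x \<in> W}"
    using W by simp
  ultimately obtain e where "e > 0" "ball 0 e \<subseteq> {t. t *\<^sub>R x \<in> W}"
    by (meson open_contains_ball)
  then show ?thesis
    using that[of e] W(3) by (auto simp: subset_iff)
qed

text \<open>
  The absolute value on the right is there because solidity compares absolute values; it also
  allows \<open>t\<close> to be negative.
\<close>

lemma abs_scaleR_le_abs_scaleR:
  fixes z u :: "'a::riesz_space"
  assumes "\<bar>z\<bar> \<le> u"
  shows "\<bar>t *\<^sub>R z\<bar> \<le> \<bar>t *\<^sub>R u\<bar>"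
proof -
  have z: "z \<le> u" "- z \<le> u"
    using assms abs_ge_self[of z] abs_ge_minus_self[of z] order_trans by blast+
  have "t *\<^sub>R z \<le> \<bar>t\<bar> *\<^sub>R u" "- (t *\<^sub>R z) \<le> \<bar>t\<bar> *\<^sub>R u"
    using scaleR_left_mono[OF z(1), of "\<bar>t\<bar>"] scaleR_left_mono[OF z(2), of "\<bar>t\<bar>"]
    by (cases "t \<ge> 0"; simp)+
  then have "\<bar>t *\<^sub>R z\<bar> \<le> \<bar>t\<bar> *\<^sub>R u"
    by (rule abs_leI)
  also have "\<dots> \<le> \<bar>t *\<^sub>R u\<bar>"
    using abs_ge_self[of "t *\<^sub>R u"] abs_ge_minus_self[of "t *\<^sub>R u"]
    by (cases "t \<ge> 0") simp_all
  finally show ?thesis .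
qed

lemma order_bounded_imp_abs_bounded:
  fixes S :: "'a::riesz_space set"
  assumes "order_bounded S"
  obtains u where "\<And>z. z \<in> S \<Longrightarrow> \<bar>z\<bar> \<le> u"
proof -
  obtain x y where S: "S \<subseteq> {x..y}"
    using assms by (auto simp: order_bounded_def)
  have "\<bar>z\<bar> \<le> \<bar>x\<bar> + \<bar>y\<bar>" if "z \<in> S" for z
  proof (rule abs_leI)
    have z: "x \<le> z" "z \<le> y"
      using S that by auto
    have "z \<le> \<bar>y\<bar>"
      using z(2) abs_ge_self order_trans by blast
    then show "z \<le> \<bar>x\<bar> + \<bar>y\<bar>"
      using add_mono[OF abs_ge_zero[of x]] by fastforce
    have "- z \<le> \<bar>x\<bar>"
      using z(1) abs_ge_minus_self[of x] le_imp_neg_le order_trans by blast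
    then show "- z \<le> \<bar>x\<bar> + \<bar>y\<bar>"
      using add_mono[OF _ abs_ge_zero[of y]] by fastforce
  qed
  then show ?thesis
    using that by blast
qed

text \<open>
  If \<open>u\<close> dominates \<open>S\<close> in absolute value and \<open>u / c\<close> lies in a solid neighborhood, solidity puts all
  of \<open>S / c\<close> into it; and \<open>u / c\<close> does lie there once \<open>\<bar>c\<bar>\<close> is large.
\<close>

lemma order_bounded_imp_top_bounded:
  fixes \<tau> :: "'a::riesz_space topology"
  assumes ls: "locally_solid \<tau>" and S: "order_bounded S"
  shows "top_bounded \<tau> S"
  unfolding top_bounded_def
proof (intro allI impI)
  fix V assume "zero_nhd \<tau> V"
  then obtain W where "openin \<tau> W" "0 \<in> W" "W \<subseteq> V"
    by (auto simp: zero_nhd_def)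
  with ls obtain O' A where O': "openin \<tau> O'" "0 \<in> O'" "O' \<subseteq> A" and A: "solid A" "A \<subseteq> V"
    unfolding locally_solid_def neighbourhood_base_at_def by (metis order_trans)
  have lin: "linear_topology \<tau>"
    using ls by (simp add: locally_solid_def)
  have "zero_nhd \<tau> A"
    using O' by (auto simp: zero_nhd_def)
  obtain u where u: "\<And>z. z \<in> S \<Longrightarrow> \<bar>z\<bar> \<le> u"
    using order_bounded_imp_abs_bounded[OF S] by blast
  obtain e where e: "e > 0" "\<And>t. \<bar>t\<bar> < e \<Longrightarrow> t *\<^sub>R u \<in> A"
    using zero_nhd_contains_small_multiples[OF lin \<open>zero_nhd \<tau> A\<close>] by blast
  have "S \<subseteq> (*\<^sub>R) c ` V" if c: "2 / e \<le> \<bar>c\<bar>" for c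
  proof
    fix z assume "z \<in> S"
    have "c \<noteq> 0"
      using c e(1) by (auto simp: divide_simps)
    have "2 \<le> \<bar>c\<bar> * e"
      using c e(1) by (simp add: pos_divide_le_eq)
    then have "\<bar>inverse c\<bar> < e"
      using \<open>c \<noteq> 0\<close> by (simp add: abs_inverse field_simps)
    then have "inverse c *\<^sub>R u \<in> A"
      by (rule e(2))
    then have "inverse c *\<^sub>R z \<in> A"
      using A(1) abs_scaleR_le_abs_scaleR[OF u[OF \<open>z \<in> S\<close>]] by (meson solid_def)
    then have "inverse c *\<^sub>R z \<in> V"
      using A(2) by blast
    moreover have "z = c *\<^sub>R (inverse c *\<^sub>R z)"
      using \<open>c \<noteq> 0\<close> by simp
    ultimately show "z \<in> (*\<^sub>R) c ` V"
      by blast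
  qed
  then show "absorbs V S"
    using e(1) unfolding absorbs_def by (intro exI[of _ "2 / e"]) simp
qed

lemma top_bounded_imp_order_bounded:
  fixes U :: "'a::riesz_space set"
  assumes U: "zero_nhd \<tau> U" "order_bounded U" and S: "top_bounded \<tau> S"
  shows "order_bounded S"
proof -
  obtain r where "r > 0" and r: "S \<subseteq> (*\<^sub>R) r ` U"
    using U(1) S unfolding top_bounded_def absorbs_def by (metis abs_ge_self)
  obtain x y where "U \<subseteq> {x..y}"
    using U(2) by (auto simp: order_bounded_def)
  then have "(*\<^sub>R) r ` U \<subseteq> {r *\<^sub>R x..r *\<^sub>R y}"
    using \<open>r > 0\<close> by (auto simp: subset_iff intro!: scaleR_left_mono)
  with r show ?thesis
    unfolding order_bounded_def by blast
qed

lemma continuous_map_imp_top_bounded_image: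
  assumes \<tau>: "topspace \<tau> = UNIV" and T: "linear T" "continuous_map \<tau> \<sigma> T"
    and S: "top_bounded \<tau> S"
  shows "top_bounded \<sigma> (T ` S)"
  unfolding top_bounded_def
proof (intro allI impI)
  fix V assume "zero_nhd \<sigma> V"
  then obtain W where W: "openin \<sigma> W" "0 \<in> W" "W \<subseteq> V"
    by (auto simp: zero_nhd_def)
  have "zero_nhd \<tau> {x. T x \<in> W}"
    unfolding zero_nhd_def
    using openin_preimage[OF T(2) \<tau> W(1)] W(2) linear_0[OF T(1)] by auto
  then obtain r where r: "r > 0" "\<And>c. r \<le> \<bar>c\<bar> \<Longrightarrow> S \<subseteq> (*\<^sub>R) c ` {x. T x \<in> W}"
    using S unfolding top_bounded_def absorbs_def by blast
  have "T ` S \<subseteq> (*\<^sub>R) c ` V" if c: "r \<le> \<bar>c\<bar>" for c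
  proof
    fix y assume "y \<in> T ` S"
    then obtain w where "y = T (c *\<^sub>R w)" "T w \<in> W"
      using r(2)[OF c] by blast
    then show "y \<in> (*\<^sub>R) c ` V"
      using W(3) by (auto simp: linear_scale[OF T(1)])
  qed
  with r(1) show "absorbs V (T ` S)"
    unfolding absorbs_def by blast
qed

text \<open>
  If a neighborhood \<open>V\<close> of zero in the target absorbs \<open>T ` U\<close>, say \<open>T ` U \<subseteq> r V\<close>, then \<open>T\<close> maps
  \<open>U / r\<close> into \<open>V\<close>; this is continuity at zero, and translations carry it to every other point.
\<close>

lemma bounded_image_of_zero_nhd_imp_continuous_map:
  assumes \<tau>: "linear_topology \<tau>" and \<sigma>: "linear_topology \<sigma>" and T: "linear T"
    and U: "zero_nhd \<tau> U" and TU: "top_bounded \<sigma> (T ` U)"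
  shows "continuous_map \<tau> \<sigma> T"
proof -
  have top: "topspace \<tau> = UNIV" "topspace \<sigma> = UNIV"
    using \<tau> \<sigma> by (auto simp: linear_topology_def)
  obtain U0 where U0: "openin \<tau> U0" "0 \<in> U0" "U0 \<subseteq> U"
    using U by (auto simp: zero_nhd_def)
  have "\<exists>W. openin \<tau> W \<and> x \<in> W \<and> W \<subseteq> {x. T x \<in> V}" if V: "openin \<sigma> V" "T x \<in> V" for V x
  proof -
    let ?V = "{v. v + T x \<in> V}"
    have "openin \<sigma> ?V"
      by (rule openin_preimage[OF linear_topology_continuous_translation[OF \<sigma>] top(2) V(1)])
    then have "zero_nhd \<sigma> ?V"
      unfolding zero_nhd_def using V(2) by auto
    then obtain r where "r > 0" and r: "T ` U \<subseteq> (*\<^sub>R) r ` ?V"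
      using TU unfolding top_bounded_def absorbs_def by (metis abs_ge_self)
    let ?W = "{w. r *\<^sub>R (w + (- x)) \<in> U0}"
    have "openin \<tau> ?W"
      using openin_preimage[OF linear_topology_continuous_translation[OF \<tau>, of "- x"] top(1)
          openin_preimage[OF linear_topology_continuous_scaleR[OF \<tau>, of r] top(1) U0(1)]]
      by simp
    moreover have "x \<in> ?W"
      using U0(2) by simp
    moreover have "T w \<in> V" if "w \<in> ?W" for w
    proof -
      have "T (r *\<^sub>R (w - x)) \<in> (*\<^sub>R) r ` ?V"
        using that U0(3) r by auto
      then obtain v where "r *\<^sub>R (T w - T x) = r *\<^sub>R v" "v + T x \<in> V"
        by (auto simp: linear_scale[OF T] linear_diff[OF T])
      then show ?thesis
        using \<open>r > 0\<close> by auto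
    qed
    ultimately show ?thesis
      by blast
  qed
  then have "openin \<tau> {x. T x \<in> V}" if "openin \<sigma> V" for V
    using that by (subst openin_subopen) blast
  then show ?thesis
    using top by (simp add: continuous_map)
qed

theorem theorem3p2:
  fixes \<tau>1 :: "'a::riesz_space topology" and \<tau>2 :: "'b::riesz_space topology"
  assumes "locally_solid \<tau>1" and "locally_solid \<tau>2"
    and "\<exists>U. zero_nhd \<tau>1 U \<and> order_bounded U"
    and "\<exists>U. zero_nhd \<tau>2 U \<and> order_bounded U"
    and "(\<exists>\<B>. countable \<B> \<and> (\<forall>V\<in>\<B>. zero_nhd \<tau>1 V) \<and>
          neighbourhood_base_at 0 (\<lambda>V. V \<in> \<B>) \<tau>1)
       \<or> ((\<exists>U. zero_nhd \<tau>1 U \<and> top_bounded \<tau>1 U \<and> convex U) \<and>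
          (\<exists>U. zero_nhd \<tau>2 U \<and> top_bounded \<tau>2 U \<and> convex U))
       \<or> (locally_convex \<tau>1 \<and> Hausdorff_space \<tau>1 \<and> locally_convex \<tau>2 \<and> Hausdorff_space \<tau>2)
       \<or> (bornological \<tau>1 \<and> locally_convex \<tau>2)"
  shows "(order_bounded_ops :: ('a \<Rightarrow> 'b) set) = top_bounded_ops \<tau>1 \<tau>2 \<and>
         top_bounded_ops \<tau>1 \<tau>2 = top_continuous_ops \<tau>1 \<tau>2"
proof -
  have lin: "linear_topology \<tau>1" "linear_topology \<tau>2"
    using assms(1,2) by (auto simp: locally_solid_def)
  have top1: "topspace \<tau>1 = UNIV"
    using lin(1) by (simp add: linear_topology_def)
  obtain U where U: "zero_nhd \<tau>1 U" "order_bounded U"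
    using assms(3) by blast
  have bdd1: "top_bounded \<tau>1 S \<longleftrightarrow> order_bounded S" for S
    using order_bounded_imp_top_bounded[OF assms(1)] top_bounded_imp_order_bounded[OF U] by blast
  have bdd2: "top_bounded \<tau>2 S \<longleftrightarrow> order_bounded S" for S
    using order_bounded_imp_top_bounded[OF assms(2)] top_bounded_imp_order_bounded assms(4) by blast
  have "continuous_map \<tau>1 \<tau>2 T \<longleftrightarrow> (\<forall>S. top_bounded \<tau>1 S \<longrightarrow> top_bounded \<tau>2 (T ` S))"
    if T: "linear T" for T
  proof
    show "\<forall>S. top_bounded \<tau>1 S \<longrightarrow> top_bounded \<tau>2 (T ` S)" if "continuous_map \<tau>1 \<tau>2 T"
      using continuous_map_imp_top_bounded_image[OF top1 T that] by blast
    show "continuous_map \<tau>1 \<tau>2 T" if "\<forall>S. top_bounded \<tau>1 S \<longrightarrow> top_bounded \<tau>2 (T ` S)"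
      using bounded_image_of_zero_nhd_imp_continuous_map[OF lin T U(1)] that U(2) bdd1 by blast
  qed
  then have "top_bounded_ops \<tau>1 \<tau>2 = top_continuous_ops \<tau>1 \<tau>2"
    unfolding top_bounded_ops_def top_continuous_ops_def by blast
  moreover have "(order_bounded_ops :: ('a \<Rightarrow> 'b) set) = top_bounded_ops \<tau>1 \<tau>2"
    unfolding order_bounded_ops_def top_bounded_ops_def bdd1 bdd2 ..
  ultimately show ?thesis
    by blast
qed

end
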